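(* Let $G$ be a paratopological group. If $G$ contains a subspace homeomorphic to a stationary subset of some uncountable regular cardinal, then: (1) $G$ is not hereditarily normal or $G$ is not hereditarily collectionwise Hausdorff; (2) $G$ is not hereditarily collectionwise normal.
   Context: All spaces are Tychonoff. A paratopological group is a group endowed with a topology for which the group multiplication $G\times G\to G$ is (jointly) continuous. Subsets of ordinals carry the subspace topology of the order topology. A subset of a regular uncountable cardinal $\kappa$ is stationary if it meets every closed unbounded subset of $\kappa$. A space is hereditarily $P$ if every subspace has property $P$. *)

theory Defs
  imports "HOL-Analysis.Analysis" "HOL-Algebra.Group"
begin

definition ord_topology :: "'k rel \<Rightarrow> 'k topology" where
  "ord_topology r = topology_generated_by
     (insert (Field r)
        ({{x. (x, a) \<in> r \<and> x \<noteq> a} | a. a \<in> Field r} \<union>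
         {{x. (a, x) \<in> r \<and> x \<noteq> a} | a. a \<in> Field r}))"

definition club :: "'k rel \<Rightarrow> 'k set \<Rightarrow> bool" where
  "club r C \<longleftrightarrow> C \<subseteq> Field r \<and> closedin (ord_topology r) C \<and> cofinal C r"

definition stationary :: "'k rel \<Rightarrow> 'k set \<Rightarrow> bool" where
  "stationary r S \<longleftrightarrow> S \<subseteq> Field r \<and> (\<forall>C. club r C \<longrightarrow> S \<inter> C \<noteq> {})"

definition uncountable_regular_cardinal :: "'k rel \<Rightarrow> bool" where
  "uncountable_regular_cardinal r \<longleftrightarrow>
     Card_order r \<and> regularCard r \<and> \<not> countable (Field r)"

definition collectionwise_Hausdorff :: "'a topology \<Rightarrow> bool" where
  "collectionwise_Hausdorff X \<longleftrightarrow>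
     (\<forall>D. closedin X D \<and> subtopology X D = discrete_topology D \<longrightarrow>
        (\<exists>U. (\<forall>d\<in>D. openin X (U d) \<and> d \<in> U d) \<and>
             (\<forall>d\<in>D. \<forall>e\<in>D. d \<noteq> e \<longrightarrow> disjnt (U d) (U e))))"

definition discrete_family :: "'a topology \<Rightarrow> 'a set set \<Rightarrow> bool" where
  "discrete_family X \<F> \<longleftrightarrow>
     (\<forall>x\<in>topspace X. \<exists>V. openin X V \<and> x \<in> V \<and>
        (\<forall>F\<in>\<F>. \<forall>F'\<in>\<F>. F \<inter> V \<noteq> {} \<and> F' \<inter> V \<noteq> {} \<longrightarrow> F = F'))"

definition collectionwise_normal :: "'a topology \<Rightarrow> bool" where
  "collectionwise_normal X \<longleftrightarrow>
     (\<forall>\<F>. (\<forall>F\<in>\<F>. closedin X F) \<and> discrete_family X \<F> \<longrightarrow>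
        (\<exists>U. (\<forall>F\<in>\<F>. openin X (U F) \<and> F \<subseteq> U F) \<and>
             (\<forall>F\<in>\<F>. \<forall>F'\<in>\<F>. F \<noteq> F' \<longrightarrow> disjnt (U F) (U F'))))"

definition paratopological_group :: "('g, 'b) monoid_scheme \<Rightarrow> 'g topology \<Rightarrow> bool" where
  "paratopological_group G X \<longleftrightarrow>
     group G \<and> topspace X = carrier G \<and>
     continuous_map (prod_topology X X) X (\<lambda>p. fst p \<otimes>\<^bsub>G\<^esub> snd p)"

definition Tychonoff_space :: "'a topology \<Rightarrow> bool" where
  "Tychonoff_space X \<longleftrightarrow> completely_regular_space X \<and> Hausdorff_space X"

end

theory Submission
  imports Defs "HOL-Library.Countable_Set_Type"
begin

text \<open>
  Let \<open>x\<close> embed the stationary set \<open>S\<close> into \<open>G\<close> and put \<open>f a b = x a \<cdot> x b\<close>. This map is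
  continuous, injective in \<open>a\<close>, and an embedding in \<open>b\<close> because left translations are
  homeomorphisms; continuity of inversion is never used. Two graphs \<open>D h = {f a (h a) | a. a \<in> T}\<close>, with \<open>T\<close>
  a stationary subset of \<open>S\<close> and \<open>h\<close> growing fast, are separated, so hereditary normality
  gives open \<open>U h\<close> containing \<open>D h\<close> whose closures meet only in points common to the closures
  of the graphs. Pressing down shows that, for large \<open>\<xi> < \<delta>\<close> with \<open>\<delta> \<in> T\<close> suitably closed,
  \<open>f \<xi> \<delta>\<close> lies in both \<open>closure (U h)\<close>, hence in both \<open>closure (D h)\<close>. On the other hand
  \<open>f \<xi> \<delta> \<in> closure (D h)\<close> forces \<open>f \<xi> \<delta> = f \<delta> (h \<delta>)\<close>: points \<open>f \<alpha> (h \<alpha>)\<close> with \<open>\<alpha> < \<delta>\<close>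
  close to \<open>\<delta>\<close> are near \<open>f \<delta> \<delta>\<close>; those with \<open>\<alpha>\<close> below a fixed bound form a small set, whose
  closure contains few points of a row by the collectionwise Hausdorff property; and those
  with \<open>\<alpha> > \<delta>\<close> are excluded since the tail squares of \<open>f\<close> have at most one common cluster
  point. Two functions \<open>h\<close> that differ everywhere then give a contradiction.
\<close>

no_notation lesspoll (infixl "\<prec>" 50)
no_notation eq_closure_of ("closure'_of\<index>")

section \<open>Closed unbounded sets in a regular cardinal\<close>

locale regular_cardinal =
  fixes r :: "'k rel"
  assumes uncountable_regular: "uncountable_regular_cardinal r"
begin

unbundle cardinal_syntax

text \<open>Weak inequalities appear throughout as negated strict ones: for members of
  \<open>Field r\<close>, \<open>\<not> b \<prec> a\<close> means that \<open>a\<close> is at most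
  \<open>b\<close>.\<close>

definition lt :: "'k \<Rightarrow> 'k \<Rightarrow> bool" (infix "\<prec>" 50)
  where "a \<prec> b \<longleftrightarrow> (a, b) \<in> r \<and> a \<noteq> b"

lemma Card: "Card_order r" and regular: "regularCard r" and uncountable: "\<not> countable (Field r)"
  using uncountable_regular by (auto simp: uncountable_regular_cardinal_def)

lemma infinite_Field: "\<not> finite (Field r)"
  using uncountable countable_finite by blast

lemma well_order: "Well_order r"
  using Card card_order_on_well_order_on by blast

lemma lt_irrefl [simp]: "\<not> a \<prec> a"
  by (simp add: lt_def)

lemma lt_Field: "a \<prec> b \<Longrightarrow> a \<in> Field r \<and> b \<in> Field r"
  by (auto simp: lt_def Field_def)

lemma lt_trans [trans]: "a \<prec> b \<Longrightarrow> b \<prec> c \<Longrightarrow> a \<prec> c"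
proof -
  have "trans r" "antisym r"
    using well_order by (simp_all add: order_on_defs)
  then show "a \<prec> b \<Longrightarrow> b \<prec> c \<Longrightarrow> a \<prec> c"
    unfolding lt_def by (blast dest: transD antisymD)
qed

lemma lt_total:
  assumes "a \<in> Field r" "b \<in> Field r"
  shows "a \<prec> b \<or> a = b \<or> b \<prec> a"
proof -
  have "total_on (Field r) r"
    using well_order by (simp add: order_on_defs)
  then show ?thesis
    using assms unfolding lt_def total_on_def by blast
qed

lemma not_lt_lt_trans: "\<not> b \<prec> a \<Longrightarrow> b \<prec> c \<Longrightarrow> a \<in> Field r \<Longrightarrow> a \<prec> c"
  using lt_Field[of b c] lt_total[of a b] lt_trans[of a b c] by blast

lemma lt_not_lt_trans: "a \<prec> b \<Longrightarrow> \<not> c \<prec> b \<Longrightarrow> c \<in> Field r \<Longrightarrow> a \<prec> c"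
  using lt_Field[of a b] lt_total[of b c] lt_trans[of a b c] by blast

lemma least_element:
  assumes "A \<subseteq> Field r" "A \<noteq> {}"
  obtains m where "m \<in> A" "\<And>a. a \<in> A \<Longrightarrow> \<not> a \<prec> m"
proof -
  have "wf (r - Id)"
    using well_order by (simp add: order_on_defs)
  then obtain m where "m \<in> A" "\<And>y. (y, m) \<in> r - Id \<Longrightarrow> y \<notin> A"
    using assms by (meson wfE_min' )
  then show thesis
    using that by (auto simp: lt_def)
qed

lemma exists_greater: "a \<in> Field r \<Longrightarrow> \<exists>b. a \<prec> b"
  using infinite_Card_order_limit[OF Card infinite_Field] by (auto simp: lt_def)

lemma exists_greater2: "a \<in> Field r \<Longrightarrow> b \<in> Field r \<Longrightarrow> \<exists>c. a \<prec> c \<and> b \<prec> c"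
  using exists_greater[of a] exists_greater[of b] lt_total[of a b] lt_trans by blast

section \<open>Sets of cardinality below \<open>r\<close>, and boundedness\<close>

lemma small_bounded:
  assumes "B \<subseteq> Field r" "|B| <o r"
  obtains b where "b \<in> Field r" "\<And>x. x \<in> B \<Longrightarrow> x \<prec> b"
proof -
  have "\<not> |B| =o r"
    using assms(2) not_ordLess_ordIso by blast
  then have "\<not> cofinal B r"
    using regular assms(1) by (auto simp: regularCard_def)
  then obtain a where a: "a \<in> Field r" "\<And>x. x \<in> B \<Longrightarrow> \<not> a \<prec> x"
    by (auto simp: cofinal_def lt_def)
  obtain b where "a \<prec> b"
    using exists_greater a(1) by blast
  then show thesis
    using that[of b] a assms(1) lt_Field not_lt_lt_trans by (metis subsetD)
qed

lemma unbounded_card: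
  assumes "B \<subseteq> Field r" "\<And>a. a \<in> Field r \<Longrightarrow> \<exists>b\<in>B. a \<prec> b"
  shows "|B| =o r"
proof -
  have "cofinal B r"
    using assms(2) unfolding cofinal_def lt_def by blast
  then show ?thesis
    using regular assms(1) by (simp add: regularCard_def)
qed

lemma small_segment: "|{x. x \<prec> a}| <o r"
proof (cases "a \<in> Field r")
  case True
  have "{x. x \<prec> a} = underS r a"
    by (auto simp: lt_def underS_def)
  then show ?thesis
    using card_of_underS[OF Card True] by simp
next
  case False
  then have e: "{x. x \<prec> a} = {}"
    using lt_Field by blast
  show ?thesis
    unfolding e
    by (rule finite_ordLess_infinite[OF card_of_Well_order well_order])
      (simp_all add: infinite_Field Field_card_of)
qed

lemma small_countable: "countable B \<Longrightarrow> |B| <o r"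
proof (rule ccontr)
  assume B: "countable B" and "\<not> |B| <o r"
  then have "r \<le>o |B|"
    using well_order card_of_Well_order not_ordLess_iff_ordLeq by blast
  then have "|Field r| \<le>o |B|"
    using card_of_Field_ordIso[OF Card] ordIso_ordLeq_trans by blast
  then have "countable (Field r)"
    using B by (rule countable_ordLeq)
  then show False
    using uncountable by simp
qed

lemma small_Times: 
  fixes A B :: "'k set"
  assumes "|A| <o r" "|B| <o r"
  shows "|A \<times> B| <o r"
proof -
  have "stable r"
    using regularCard_stable Card regular infinite_Field by blast
  then show ?thesis
    using assms by (intro stable_elim)
qed

lemma small_image: "|A| <o r \<Longrightarrow> |f ` A| <o r"
  using card_of_image ordLeq_ordLess_trans by blast

text \<open>
  All clubs needed are of this form. A set-valued binary \<open>B\<close> lets a single instance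
  encode closure under several functions of one or two arguments.
\<close>

definition closed_under :: "('k \<Rightarrow> 'k \<Rightarrow> 'k set) \<Rightarrow> 'k \<Rightarrow> bool"
  where "closed_under B d \<longleftrightarrow> (\<forall>x y. x \<prec> d \<longrightarrow> y \<prec> d \<longrightarrow> (\<forall>b\<in>B x y. b \<prec> d))"

definition closing :: "('k \<Rightarrow> 'k \<Rightarrow> 'k set) \<Rightarrow> bool"
  where "closing B \<longleftrightarrow> (\<forall>x\<in>Field r. \<forall>y\<in>Field r. countable (B x y) \<and> B x y \<subseteq> Field r)"

text \<open>Regularity bounds each countable set \<open>B x y\<close>, and then bounds the fewer
  than \<open>r\<close> many bounds chosen for the pairs from an initial segment.\<close>

lemma closing_step:
  assumes B: "closing B" and a: "a \<in> Field r"
  obtains b where "a \<prec> b" "\<And>x y z. \<not> a \<prec> x \<Longrightarrow> \<not> a \<prec> y \<Longrightarrow> x \<in> Field r \<Longrightarrow> y \<in> Field r \<Longrightarrow> z \<in> B x y \<Longrightarrow> z \<prec> b"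
proof -
  obtain a' where a': "a \<prec> a'"
    using exists_greater a by blast
  have "\<exists>b\<in>Field r. \<forall>z\<in>B x y. z \<prec> b" if "x \<in> Field r" "y \<in> Field r" for x y
  proof -
    have "countable (B x y)" "B x y \<subseteq> Field r"
      using B that unfolding closing_def by blast+
    then show ?thesis
      by (meson small_bounded small_countable)
  qed
  then obtain g where g: "\<And>x y. x \<in> Field r \<Longrightarrow> y \<in> Field r \<Longrightarrow> g x y \<in> Field r \<and> (\<forall>z\<in>B x y. z \<prec> g x y)"
    unfolding Bex_def by metis
  let ?I = "{x. x \<prec> a'}"
  have "|(\<lambda>(x, y). g x y) ` (?I \<times> ?I)| <o r"
    by (intro small_image small_Times small_segment)
  moreover have "(\<lambda>(x, y). g x y) ` (?I \<times> ?I) \<subseteq> Field r"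
    using g lt_Field by auto
  ultimately obtain c where c: "c \<in> Field r" "\<And>x. x \<in> (\<lambda>(x, y). g x y) ` (?I \<times> ?I) \<Longrightarrow> x \<prec> c"
    by (meson small_bounded)
  obtain b where b: "a \<prec> b" "c \<prec> b"
    using exists_greater2 a c(1) by blast
  show thesis
  proof (rule that[OF b(1)])
    fix x y z assume *: "\<not> a \<prec> x" "\<not> a \<prec> y" "x \<in> Field r" "y \<in> Field r" "z \<in> B x y"
    then have "x \<prec> a'" "y \<prec> a'"
      using not_lt_lt_trans[OF _ a'] by simp_all
    then have "g x y \<prec> c"
      by (intro c(2)) auto
    moreover have "z \<prec> g x y"
      using * g by simp
    ultimately show "z \<prec> b"
      using b(2) lt_trans[of z _ c] lt_trans[of z c b] by simp
  qed
qed

text \<open>Iterating \<open>closing_step\<close> countably often gives an increasing sequence,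
  bounded because \<open>r\<close> is regular and uncountable. Its supremum is closed: two arguments
  below it are at most a common stage, and the next stage exceeds all their values.\<close>

lemma exists_closed:
  assumes B: "closing B" and a: "a \<in> Field r"
  shows "\<exists>d. a \<prec> d \<and> closed_under B d"
proof -
  have "\<exists>b. a \<prec> b \<and> (\<forall>x y z. \<not> a \<prec> x \<longrightarrow> \<not> a \<prec> y \<longrightarrow> x \<in> Field r \<longrightarrow> y \<in> Field r \<longrightarrow> z \<in> B x y \<longrightarrow> z \<prec> b)"
    if "a \<in> Field r" for a
    by (rule closing_step[OF B that]) blast
  then obtain s where s: "\<And>a. a \<in> Field r \<Longrightarrow> a \<prec> s a"
    "\<And>a x y z. a \<in> Field r \<Longrightarrow> \<not> a \<prec> x \<Longrightarrow> \<not> a \<prec> y \<Longrightarrow> x \<in> Field r \<Longrightarrow> y \<in> Field r \<Longrightarrow> z \<in> B x y \<Longrightarrow> z \<prec> s a"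
    by metis
  define t where "t n = (s ^^ n) a" for n
  have t0: "t 0 = a" and tS: "t (Suc n) = s (t n)" for n
    by (simp_all add: t_def)
  have tF: "t n \<in> Field r" for n
    by (induction n) (use a s(1) lt_Field in \<open>auto simp: t0 tS\<close>)
  have "|range t| <o r"
    by (intro small_countable) simp
  then obtain u where u: "u \<in> Field r" "\<And>n. t n \<prec> u"
    by (rule small_bounded[rotated]) (use tF in auto)
  \<comment> \<open>Minimality of \<open>d\<close> means that each point below it is at most some
    \<open>t m\<close>; \<open>below\<close> extends this to all later stages.\<close>
  obtain d where d: "d \<in> {u. \<forall>n. t n \<prec> u}" "\<And>v. v \<in> {u. \<forall>n. t n \<prec> u} \<Longrightarrow> \<not> v \<prec> d"
    by (rule least_element[of "{u. \<forall>n. t n \<prec> u}"]) (use u lt_Field in blast)+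
  have below: "\<exists>m. \<forall>n\<ge>m. \<not> t n \<prec> x" if x: "x \<prec> d" for x
  proof -
    obtain m where m: "\<not> t m \<prec> x"
      using d(2)[of x] x by auto
    have "\<not> t n \<prec> x" if "n \<ge> m" for n
      using that
    proof (induction rule: dec_induct)
      case (step n)
      then show ?case
        using lt_trans[OF s(1)[OF tF[of n]], of x] unfolding tS by blast
    qed (use m in simp)
    then show ?thesis by blast
  qed
  have "closed_under B d"
    unfolding closed_under_def
  proof (intro allI impI ballI)
    fix x y z assume *: "x \<prec> d" "y \<prec> d" "z \<in> B x y"
    then obtain m n where mn: "\<And>k. k \<ge> m \<Longrightarrow> \<not> t k \<prec> x" "\<And>k. k \<ge> n \<Longrightarrow> \<not> t k \<prec> y"
      using below[of x] below[of y] by blast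
    have "z \<prec> s (t (max m n))"
      using * lt_Field by (intro s(2)[OF tF mn(1) mn(2)]) auto
    then have "z \<prec> t (Suc (max m n))"
      by (simp only: tS)
    then show "z \<prec> d"
      using d(1) lt_trans[of z _ d] by blast
  qed
  then show ?thesis
    using d(1) t0 by auto
qed

lemma closing_Un: "closing B \<Longrightarrow> closing B' \<Longrightarrow> closing (\<lambda>x y. B x y \<union> B' x y)"
  unfolding closing_def by simp

lemma closed_under_Un:
  "closed_under (\<lambda>x y. B x y \<union> B' x y) d \<longleftrightarrow> closed_under B d \<and> closed_under B' d"
  unfolding closed_under_def by blast

section \<open>Neighbourhoods in the order topology, and clubs of closed points\<close>

lemma topspace_ord_topology: "topspace (ord_topology r) = Field r"
  unfolding ord_topology_def topology_generated_by_topspace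
  by (auto simp: Field_def)

lemma openin_lt: "a \<in> Field r \<Longrightarrow> openin (ord_topology r) {x. x \<prec> a}"
  unfolding ord_topology_def lt_def by (rule topology_generated_by_Basis) blast

lemma openin_gt: "a \<in> Field r \<Longrightarrow> openin (ord_topology r) {x. a \<prec> x}"
  unfolding ord_topology_def lt_def
  by (rule topology_generated_by_Basis) (force simp: eq_commute)

text \<open>With \<open>b\<close> the successor of \<open>a\<close>, this is the open segment below
  \<open>b\<close>.\<close>

lemma openin_not_gt:
  assumes "a \<in> Field r"
  shows "openin (ord_topology r) {x \<in> Field r. \<not> a \<prec> x}"
proof -
  obtain b where b: "a \<prec> b" "\<And>c. a \<prec> c \<Longrightarrow> \<not> c \<prec> b"
    by (rule least_element[of "{c. a \<prec> c}"]) (use exists_greater[OF assms] lt_Field in blast)+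
  then have "{x \<in> Field r. \<not> a \<prec> x} = {x. x \<prec> b}"
    using lt_Field lt_total[of _ b] lt_trans by blast
  then show ?thesis
    using openin_lt b lt_Field by metis
qed

text \<open>Induction over the generation of \<open>W\<close> from rays: a lower ray admits
  \<open>c\<close> itself as left endpoint, an upper ray its own endpoint, and an intersection the
  larger of two. The point \<open>c\<close> shows that \<open>a\<close> is not the least
  element.\<close>

lemma ord_topology_nbhd:
  assumes "openin (ord_topology r) W" "a \<in> W" "c \<prec> a"
  obtains g where "g \<prec> a" "\<And>x. g \<prec> x \<Longrightarrow> \<not> a \<prec> x \<Longrightarrow> x \<in> W"
proof -
  have "generate_topology_on (insert (Field r)
        ({{x. (x, a) \<in> r \<and> x \<noteq> a} | a. a \<in> Field r} \<union>
         {{x. (a, x) \<in> r \<and> x \<noteq> a} | a. a \<in> Field r})) W"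
    using assms(1) unfolding ord_topology_def by (rule openin_topology_generated_by)
  then have "\<forall>a\<in>W. \<forall>c. c \<prec> a \<longrightarrow> (\<exists>g. g \<prec> a \<and> (\<forall>x. g \<prec> x \<longrightarrow> \<not> a \<prec> x \<longrightarrow> x \<in> W))"
  proof induction
    case (Int V W)
    have V: "\<exists>g. g \<prec> a \<and> (\<forall>x. g \<prec> x \<longrightarrow> \<not> a \<prec> x \<longrightarrow> x \<in> V)" if "a \<in> V" "c \<prec> a" for a c
      using Int.IH(1) that by blast
    have W: "\<exists>g. g \<prec> a \<and> (\<forall>x. g \<prec> x \<longrightarrow> \<not> a \<prec> x \<longrightarrow> x \<in> W)" if "a \<in> W" "c \<prec> a" for a c
      using Int.IH(2) that by blast
    show ?case
    proof (intro ballI allI impI)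
      fix a c assume a: "a \<in> V \<inter> W" "c \<prec> a"
      obtain g h where "g \<prec> a" "\<forall>x. g \<prec> x \<longrightarrow> \<not> a \<prec> x \<longrightarrow> x \<in> V"
        and "h \<prec> a" "\<forall>x. h \<prec> x \<longrightarrow> \<not> a \<prec> x \<longrightarrow> x \<in> W"
        using V[of a c] W[of a c] a by blast
      moreover obtain k where "k \<prec> a" "\<not> k \<prec> g" "\<not> k \<prec> h"
        using \<open>g \<prec> a\<close> \<open>h \<prec> a\<close> lt_Field lt_total lt_trans by (metis lt_irrefl)
      ultimately have "k \<prec> a \<and> (\<forall>x. k \<prec> x \<longrightarrow> \<not> a \<prec> x \<longrightarrow> x \<in> V \<inter> W)"
        using not_lt_lt_trans[of k] lt_Field by (metis IntI)
      then show "\<exists>g. g \<prec> a \<and> (\<forall>x. g \<prec> x \<longrightarrow> \<not> a \<prec> x \<longrightarrow> x \<in> V \<inter> W)"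
        by blast
    qed
  next
    case (UN K)
    show ?case
    proof (intro ballI allI impI)
      fix a c assume "a \<in> \<Union>K" "c \<prec> a"
      then obtain V where "V \<in> K" "a \<in> V" by blast
      then show "\<exists>g. g \<prec> a \<and> (\<forall>x. g \<prec> x \<longrightarrow> \<not> a \<prec> x \<longrightarrow> x \<in> \<Union>K)"
        using UN.IH[of V] \<open>c \<prec> a\<close> by blast
    qed
  next
    case (Basis W)
    moreover have "{x. (b, x) \<in> r \<and> x \<noteq> b} = {x. b \<prec> x}" "{x. (x, b) \<in> r \<and> x \<noteq> b} = {x. x \<prec> b}" for b
      by (auto simp: lt_def)
    ultimately consider "W = Field r" | b where "b \<in> Field r" "W = {x. x \<prec> b}"
      | b where "b \<in> Field r" "W = {x. b \<prec> x}"
      by blast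
    then show ?case
    proof cases
      case 1
      then show ?thesis using lt_Field by blast
    next
      case 2
      then show ?thesis using lt_Field not_lt_lt_trans by blast
    next
      case 3
      then show ?thesis by blast
    qed
  qed auto
  then show thesis
    using that assms by blast
qed

text \<open>Failure of closure at \<open>d\<close> is witnessed by \<open>x\<close>,
  \<open>y\<close> below \<open>d\<close> and a value \<open>z\<close> not below \<open>d\<close>.
  The same witnesses serve every point above \<open>x\<close> and \<open>y\<close> that is at most
  \<open>z\<close>, so failure is an open condition. Unboundedness is
  \<open>exists_closed\<close>.\<close>

lemma club_closed_under:
  assumes B: "closing B" and c: "c \<in> Field r"
  shows "club r {d. c \<prec> d \<and> closed_under B d}"
  unfolding club_def
proof (intro conjI)
  let ?C = "{d. c \<prec> d \<and> closed_under B d}"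
  show CF: "?C \<subseteq> Field r"
    using lt_Field by blast
  show "closedin (ord_topology r) ?C"
    unfolding closedin_def topspace_ord_topology
  proof (intro conjI CF)
    show "openin (ord_topology r) (Field r - ?C)"
    proof (subst openin_subopen, intro ballI)
      fix d assume d: "d \<in> Field r - ?C"
      show "\<exists>T. openin (ord_topology r) T \<and> d \<in> T \<and> T \<subseteq> Field r - ?C"
      proof (cases "c \<prec> d")
        case False
        then show ?thesis
          using d openin_not_gt[OF c] by blast
      next
        case True
        then have "\<not> closed_under B d"
          using d by blast
        then obtain x y z where xyz: "x \<prec> d" "y \<prec> d" "z \<in> B x y" "\<not> z \<prec> d"
          unfolding closed_under_def by blast
        have z: "z \<in> Field r"
          using B xyz lt_Field unfolding closing_def by blast
        let ?T = "{v. x \<prec> v} \<inter> {v. y \<prec> v} \<inter> {v \<in> Field r. \<not> z \<prec> v}"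
        have "openin (ord_topology r) ?T"
          using xyz lt_Field z by (intro openin_Int openin_gt openin_not_gt) blast+
        moreover have "d \<in> ?T"
          using d xyz by blast
        moreover have "?T \<subseteq> Field r - ?C"
          using xyz(3) unfolding closed_under_def by blast
        ultimately show ?thesis by blast
      qed
    qed
  qed
  show "cofinal ?C r"
    unfolding cofinal_def
  proof
    fix a assume "a \<in> Field r"
    then obtain b where b: "a \<prec> b" "c \<prec> b"
      using exists_greater2 c by blast
    then obtain d where "b \<prec> d" "closed_under B d"
      using exists_closed[OF B] lt_Field by blast
    then have "d \<in> ?C" "a \<prec> d"
      using b lt_trans[of _ b d] by simp_all
    then show "\<exists>b\<in>?C. a \<noteq> b \<and> (a, b) \<in> r"
      unfolding lt_def by blast
  qed
qed

lemma stationary_closed_under: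
  assumes "stationary r S" "closing B" "c \<in> Field r"
  obtains d where "d \<in> S" "c \<prec> d" "closed_under B d"
  using club_closed_under[OF assms(2,3)] assms(1) unfolding stationary_def by blast

end

section \<open>Separation in hereditarily normal and collectionwise Hausdorff spaces\<close>

text \<open>The set \<open>D\<close> is relatively discrete but perhaps not closed in
  \<open>X\<close>. It is closed in the open union \<open>W\<close> of its isolating neighbourhoods,
  so the collectionwise Hausdorff property is applied to the subspace \<open>W\<close>, whose open
  sets are open in \<open>X\<close>.\<close>

lemma hereditarily_collectionwise_Hausdorff_expansion:
  assumes X: "hereditarily collectionwise_Hausdorff X" "t1_space X"
    and D: "\<And>d. d \<in> D \<Longrightarrow> \<exists>V. openin X V \<and> d \<in> V \<and> (\<forall>e\<in>D. e \<in> V \<longrightarrow> e = d)"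
  obtains U where "\<And>d. d \<in> D \<Longrightarrow> openin X (U d) \<and> d \<in> U d"
    "\<And>d e. d \<in> D \<Longrightarrow> e \<in> D \<Longrightarrow> d \<noteq> e \<Longrightarrow> disjnt (U d) (U e)"
proof -
  have "\<exists>V. \<forall>d\<in>D. openin X (V d) \<and> d \<in> V d \<and> (\<forall>e\<in>D. e \<in> V d \<longrightarrow> e = d)"
    by (rule bchoice) (simp add: D)
  then obtain V where "\<forall>d\<in>D. openin X (V d) \<and> d \<in> V d \<and> (\<forall>e\<in>D. e \<in> V d \<longrightarrow> e = d)"
    by (rule exE)
  then have V: "\<And>d. d \<in> D \<Longrightarrow> openin X (V d)" and V_self: "\<And>d. d \<in> D \<Longrightarrow> d \<in> V d"
    and V_only: "\<And>d e. d \<in> D \<Longrightarrow> e \<in> D \<Longrightarrow> e \<in> V d \<Longrightarrow> e = d"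
    by simp_all
  define W where "W = (\<Union>d\<in>D. V d)"
  have W: "openin X W"
    unfolding W_def using V by (intro openin_Union) auto
  have DW: "D \<subseteq> W"
    unfolding W_def using V_self by blast
  have "openin X (V d - {d})" if "d \<in> D" for d
  proof (rule openin_diff)
    show "openin X (V d)"
      using V that by simp
    then show "closedin X {d}"
      using V_self[OF that] X(2) openin_subset by (intro closedin_t1_singleton) auto
  qed
  then have "openin X (\<Union>d\<in>D. V d - {d})"
    by (intro openin_Union) auto
  moreover have "W - D = (\<Union>d\<in>D. V d - {d})"
    unfolding W_def using V_only by auto
  ultimately have "openin X (W - D)"
    by simp
  then have "closedin (subtopology X W) D"
    unfolding closedin_def using DW W openin_subset[OF W]
    by (simp add: openin_open_subtopology topspace_subtopology Int_absorb1)
  moreover have "subtopology (subtopology X W) D = discrete_topology D"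
  proof -
    have "openin (subtopology X D) {d}" if "d \<in> D" for d
    proof -
      have "{d} = V d \<inter> D"
        using V_self V_only that by auto
      then show ?thesis
        using V[OF that] openin_subtopology by metis
    qed
    then have "discrete_topology D = subtopology X D"
      using DW openin_subset[OF W] unfolding discrete_topology_unique by auto
    then show ?thesis
      using DW by (simp add: subtopology_subtopology Int_absorb1)
  qed
  moreover have "collectionwise_Hausdorff (subtopology X W)"
    using X(1) unfolding hereditarily by blast
  ultimately have "\<exists>U. (\<forall>d\<in>D. openin (subtopology X W) (U d) \<and> d \<in> U d) \<and>
      (\<forall>d\<in>D. \<forall>e\<in>D. d \<noteq> e \<longrightarrow> disjnt (U d) (U e))"
    unfolding collectionwise_Hausdorff_def by simp
  then obtain U where U: "(\<forall>d\<in>D. openin (subtopology X W) (U d) \<and> d \<in> U d) \<and>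
      (\<forall>d\<in>D. \<forall>e\<in>D. d \<noteq> e \<longrightarrow> disjnt (U d) (U e))"
    by (rule exE)
  show thesis
  proof (rule that[of U])
    show "openin X (U d) \<and> d \<in> U d" if "d \<in> D" for d
      using U that openin_trans_full[OF _ W] by simp
    show "disjnt (U d) (U e)" if "d \<in> D" "e \<in> D" "d \<noteq> e" for d e
      using U that by simp
  qed
qed

text \<open>Deleting the common points of the two closures leaves an open subspace \<open>Z\<close>
  in which their traces are disjoint and closed. Normality of \<open>Z\<close> gives neighbourhoods
  with disjoint closures in \<open>Z\<close>, so their closures in \<open>X\<close> meet only in
  deleted points. Separatedness guarantees that \<open>D\<close> and \<open>E\<close> lie inside
  \<open>Z\<close>.\<close>

lemma hereditarily_normal_separation_closures:
  assumes X: "hereditarily normal_space X" and "separatedin X D E"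
  obtains U V where "openin X U" "openin X V" "D \<subseteq> U" "E \<subseteq> V"
    "X closure_of U \<inter> X closure_of V \<subseteq> X closure_of D \<inter> X closure_of E"
proof -
  define Z where "Z = topspace X - X closure_of D \<inter> X closure_of E"
  have Z: "openin X Z"
    unfolding Z_def by (intro openin_diff openin_topspace closedin_Int closedin_closure_of)
  have DE: "D \<subseteq> topspace X" "E \<subseteq> topspace X" "D \<inter> X closure_of E = {}" "X closure_of D \<inter> E = {}"
    using assms(2) by (auto simp: separatedin_def)
  have "closedin (subtopology X Z) (Z \<inter> X closure_of D)" "closedin (subtopology X Z) (Z \<inter> X closure_of E)"
    by (metis closedin_closure_of closedin_subtopology Int_commute)+
  moreover have "disjnt (Z \<inter> X closure_of D) (Z \<inter> X closure_of E)"
    unfolding Z_def disjnt_def by blast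
  moreover have "normal_space (subtopology X Z)"
    using X by (simp add: hereditarily)
  ultimately obtain U V where UV: "openin (subtopology X Z) U" "openin (subtopology X Z) V"
      "Z \<inter> X closure_of D \<subseteq> U" "Z \<inter> X closure_of E \<subseteq> V"
      "disjnt (subtopology X Z closure_of U) (subtopology X Z closure_of V)"
    unfolding normal_space_disjoint_closures by meson
  have UVZ: "U \<subseteq> Z" "V \<subseteq> Z" "openin X U" "openin X V"
    using UV(1,2) Z by (simp_all add: openin_open_subtopology)
  have "Z \<inter> X closure_of U \<inter> X closure_of V = {}"
    using UV(5) UVZ by (auto simp: closure_of_subtopology disjnt_def Int_absorb1)
  then have "X closure_of U \<inter> X closure_of V \<subseteq> X closure_of D \<inter> X closure_of E"
    unfolding Z_def using closure_of_subset_topspace[of X U] by blast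
  moreover have "D \<subseteq> U" "E \<subseteq> V"
    using UV(3,4) DE closure_of_subset[OF DE(1)] closure_of_subset[OF DE(2)]
    unfolding Z_def by blast+
  ultimately show thesis
    using that UVZ by blast
qed

section \<open>Separately injective images of the square of a stationary set\<close>

text \<open>
  The point \<open>c\<close> below \<open>a\<close> and \<open>b\<close> in the continuity assumption only says that they are not the
  least element, so that \<open>g\<close> and \<open>h\<close> can exist.
\<close>

locale stationary_square = regular_cardinal r for r :: "'k rel" +
  fixes S :: "'k set" and X :: "'a topology" and f :: "'k \<Rightarrow> 'k \<Rightarrow> 'a"
  assumes stationary: "stationary r S"
    and normal: "hereditarily normal_space X"
    and cwH: "hereditarily collectionwise_Hausdorff X"
    and regular_space: "regular_space X"
    and Hausdorff: "Hausdorff_space X"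
    and f_topspace: "a \<in> S \<Longrightarrow> b \<in> S \<Longrightarrow> f a b \<in> topspace X"
    and f_continuous: "a \<in> S \<Longrightarrow> b \<in> S \<Longrightarrow> c \<prec> a \<Longrightarrow> c \<prec> b \<Longrightarrow> openin X U \<Longrightarrow> f a b \<in> U \<Longrightarrow>
      \<exists>g h. g \<prec> a \<and> h \<prec> b \<and>
        (\<forall>x\<in>S. \<forall>y\<in>S. g \<prec> x \<longrightarrow> \<not> a \<prec> x \<longrightarrow> h \<prec> y \<longrightarrow> \<not> b \<prec> y \<longrightarrow> f x y \<in> U)"
    and f_inj_left: "a \<in> S \<Longrightarrow> a' \<in> S \<Longrightarrow> b \<in> S \<Longrightarrow> f a b = f a' b \<Longrightarrow> a = a'"
    and f_embedding_right: "a \<in> S \<Longrightarrow> b \<in> S \<Longrightarrow> c \<prec> b \<Longrightarrow>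
      \<exists>V. openin X V \<and> f a b \<in> V \<and> (\<forall>y\<in>S. f a y \<in> V \<longrightarrow> c \<prec> y \<and> \<not> b \<prec> y)"
begin

unbundle cardinal_syntax

lemma S_Field: "S \<subseteq> Field r"
  using stationary by (simp add: stationary_def)

lemma t1: "t1_space X"
  using Hausdorff by (rule Hausdorff_imp_t1_space)

lemma f_inj_right:
  assumes "a \<in> S" "b \<in> S" "b' \<in> S" "f a b = f a b'"
  shows "b = b'"
proof (rule ccontr)
  assume "b \<noteq> b'"
  then have "b \<prec> b' \<or> b' \<prec> b"
    using lt_total[of b b'] assms S_Field by blast
  then show False
    using f_embedding_right[of a b b'] f_embedding_right[of a b' b] assms by fastforce
qed

lemma stationary_closed:
  assumes "closing B" "c \<in> Field r"
  obtains d where "d \<in> S" "c \<prec> d" "closed_under B d"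
  using stationary_closed_under[OF stationary] assms by blast

lemma exists_S_greater:
  assumes "finite C" "C \<subseteq> Field r"
  shows "\<exists>d\<in>S. \<forall>c\<in>C. c \<prec> d"
proof -
  obtain b where b: "b \<in> Field r" "\<And>x. x \<in> C \<Longrightarrow> x \<prec> b"
    using small_bounded[OF assms(2) small_countable] countable_finite[OF assms(1)] by blast
  \<comment> \<open>Every point is closed under the empty operation, so this is just unboundedness
    of \<open>S\<close>.\<close>
  obtain d where "d \<in> S" "b \<prec> d"
    using stationary_closed[of "\<lambda>_ _. {}"] b(1) by (auto simp: closing_def)
  then show ?thesis
    using b(2) lt_trans[of _ b d] by blast
qed

section \<open>Rows against the closures of initial and tail squares\<close>

definition low :: "'k \<Rightarrow> 'a set"
  where "low n = {f x y | x y. x \<in> S \<and> y \<in> S \<and> x \<prec> n \<and> y \<prec> n}"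

definition high :: "'k \<Rightarrow> 'a set"
  where "high n = {f x y | x y. x \<in> S \<and> y \<in> S \<and> n \<prec> x \<and> n \<prec> y}"

text \<open>
  Otherwise a row contains a discrete set of full cardinality in the closure of a smaller set,
  and disjoint neighbourhoods of its points would all have to meet the smaller set.
\<close>

lemma row_avoids_low:
  assumes a: "a \<in> S" and n: "n \<in> Field r"
  shows "\<exists>k\<in>Field r. \<forall>y\<in>S. k \<prec> y \<longrightarrow> f a y \<notin> X closure_of (low n)"
proof (rule ccontr)
  assume neg: "\<not> ?thesis"
  define B where "B = {y \<in> S. f a y \<in> X closure_of (low n)}"
  have BF: "B \<subseteq> Field r"
    using S_Field by (auto simp: B_def)
  have B: "\<exists>y\<in>B. k \<prec> y" if "k \<in> Field r" for k
    using neg that unfolding B_def by blast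
  \<comment> \<open>These are the points of \<open>B\<close> with a gap of \<open>B\<close> to their
    left. They are unbounded, since the least member of \<open>B\<close> above any \<open>c\<close>
    qualifies. Their row images form a discrete set, since \<open>f_embedding_right\<close> confines
    nearby row points to the gap and \<open>b\<close> itself.\<close>
  define E where "E = {b \<in> B. \<exists>c. c \<prec> b \<and> (\<forall>y\<in>B. c \<prec> y \<longrightarrow> \<not> y \<prec> b)}"
  have EB: "E \<subseteq> B" "E \<subseteq> S"
    by (auto simp: E_def B_def)
  have "\<exists>b\<in>E. c \<prec> b" if c: "c \<in> Field r" for c
  proof -
    obtain b where b: "b \<in> {y \<in> B. c \<prec> y}" "\<And>y. y \<in> {y \<in> B. c \<prec> y} \<Longrightarrow> \<not> y \<prec> b"
      by (rule least_element[of "{y \<in> B. c \<prec> y}"]) (use BF B[OF c] in blast)+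
    then have "b \<in> E"
      unfolding E_def by blast
    then show ?thesis
      using b(1) by blast
  qed
  then have card_E: "|E| =o r"
    using unbounded_card[of E] EB BF by blast
  have "\<exists>V. openin X V \<and> d \<in> V \<and> (\<forall>e\<in>f a ` E. e \<in> V \<longrightarrow> e = d)" if d: "d \<in> f a ` E" for d
  proof -
    obtain b where b: "b \<in> E" "d = f a b"
      using d by blast
    then obtain c where c: "c \<prec> b" "\<And>y. y \<in> B \<Longrightarrow> c \<prec> y \<Longrightarrow> \<not> y \<prec> b"
      unfolding E_def by blast
    obtain V where V: "openin X V" "f a b \<in> V" "\<And>y. y \<in> S \<Longrightarrow> f a y \<in> V \<Longrightarrow> c \<prec> y \<and> \<not> b \<prec> y"
      using f_embedding_right[OF a _ c(1)] b(1) EB(2) by blast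
    have "y = b" if "y \<in> E" "f a y \<in> V" for y
    proof -
      have "y \<in> Field r" "b \<in> Field r" "\<not> b \<prec> y" "\<not> y \<prec> b"
        using that b V(3)[of y] c(2)[of y] EB BF by blast+
      then show ?thesis
        using lt_total[of y b] by blast
    qed
    then show ?thesis
      using V(1,2) b by blast
  qed
  then obtain U where U: "\<And>d. d \<in> f a ` E \<Longrightarrow> openin X (U d) \<and> d \<in> U d"
    "\<And>d e. d \<in> f a ` E \<Longrightarrow> e \<in> f a ` E \<Longrightarrow> d \<noteq> e \<Longrightarrow> disjnt (U d) (U e)"
    using hereditarily_collectionwise_Hausdorff_expansion[OF cwH t1, of "f a ` E"] by blast
  have "\<exists>p. p \<in> {x. x \<prec> n} \<times> {x. x \<prec> n} \<and> f (fst p) (snd p) \<in> U (f a b)" if b: "b \<in> E" for b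
  proof -
    have "f a b \<in> X closure_of (low n)" "openin X (U (f a b))" "f a b \<in> U (f a b)"
      using b EB U(1) unfolding B_def by blast+
    then obtain z where "z \<in> low n" "z \<in> U (f a b)"
      unfolding in_closure_of by blast
    then show ?thesis
      unfolding low_def by auto
  qed
  then obtain p where p: "\<And>b. b \<in> E \<Longrightarrow> p b \<in> {x. x \<prec> n} \<times> {x. x \<prec> n}"
    "\<And>b. b \<in> E \<Longrightarrow> f (fst (p b)) (snd (p b)) \<in> U (f a b)"
    by metis
  have "inj_on p E"
  proof (rule inj_onI)
    fix b b' assume *: "b \<in> E" "b' \<in> E" "p b = p b'"
    then have "\<not> disjnt (U (f a b)) (U (f a b'))"
      using p(2)[of b] p(2)[of b'] by (auto simp: disjnt_iff)
    then have "f a b = f a b'"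
      using U(2) * by blast
    then show "b = b'"
      using f_inj_right[OF a] * EB by blast
  qed
  moreover have "p ` E \<subseteq> {x. x \<prec> n} \<times> {x. x \<prec> n}"
    using p(1) by blast
  ultimately have "|E| \<le>o |{x. x \<prec> n} \<times> {x. x \<prec> n}|"
    using card_of_ordLeq by blast
  then have "|E| <o r"
    using small_Times[OF small_segment small_segment] ordLeq_ordLess_trans by blast
  then show False
    using card_E not_ordLess_ordIso by blast
qed

text \<open>For each \<open>m\<close> choose indices \<open>p m\<close>, \<open>q m\<close> beyond
  \<open>m\<close> with value in \<open>V\<close>. At a point \<open>d\<close> closed under
  \<open>p\<close> and \<open>q\<close>, both indices tend to \<open>d\<close> as \<open>m\<close>
  does, and continuity puts \<open>f d d\<close> into the closure.\<close>

lemma diagonal_in_closure: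
  assumes V: "\<And>m. m \<in> Field r \<Longrightarrow> V \<inter> high m \<noteq> {}"
  shows "\<exists>B. closing B \<and> (\<forall>c. \<forall>d\<in>S. c \<prec> d \<longrightarrow> closed_under B d \<longrightarrow> f d d \<in> X closure_of V)"
proof -
  have "\<exists>p q. p \<in> S \<and> q \<in> S \<and> m \<prec> p \<and> m \<prec> q \<and> f p q \<in> V" if "m \<in> Field r" for m
    using V[OF that] unfolding high_def by blast
  then obtain p q where pq: "\<And>m. m \<in> Field r \<Longrightarrow>
      p m \<in> S \<and> q m \<in> S \<and> m \<prec> p m \<and> m \<prec> q m \<and> f (p m) (q m) \<in> V"
    by metis
  have "f d d \<in> X closure_of V" if d: "d \<in> S" "c \<prec> d" "closed_under (\<lambda>x y. {p x, q x}) d" for c d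
    unfolding in_closure_of
  proof (intro conjI allI impI)
    show "f d d \<in> topspace X"
      using f_topspace d(1) by blast
    fix T assume T: "f d d \<in> T \<and> openin X T"
    obtain g h where gh: "g \<prec> d" "h \<prec> d"
      "\<And>x y. x \<in> S \<Longrightarrow> y \<in> S \<Longrightarrow> g \<prec> x \<Longrightarrow> \<not> d \<prec> x \<Longrightarrow> h \<prec> y \<Longrightarrow> \<not> d \<prec> y \<Longrightarrow> f x y \<in> T"
      using f_continuous[OF d(1) d(1) d(2) d(2), of T] T by blast
    \<comment> \<open>The larger of \<open>g\<close> and \<open>h\<close>.\<close>
    obtain m where m: "m \<prec> d" "\<not> m \<prec> g" "\<not> m \<prec> h"
      using gh(1,2) lt_total[of g h] lt_Field[of g d] lt_Field[of h d] lt_trans[of g h g] lt_irrefl by blast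
    have mF: "m \<in> Field r" "g \<in> Field r" "h \<in> Field r"
      using m gh lt_Field by blast+
    have "p m \<prec> d" "q m \<prec> d"
      using d(3) m(1) unfolding closed_under_def by blast+
    moreover then have "\<not> d \<prec> p m" "\<not> d \<prec> q m"
      using lt_trans[of d _ d] lt_irrefl by blast+
    moreover have "g \<prec> p m" "h \<prec> q m"
      using pq[OF mF(1)] not_lt_lt_trans[OF m(2) _ mF(2)] not_lt_lt_trans[OF m(3) _ mF(3)] by blast+
    ultimately have "f (p m) (q m) \<in> T"
      using gh(3) pq[OF mF(1)] by blast
    then show "\<exists>y. y \<in> V \<and> y \<in> T"
      using pq[OF mF(1)] by blast
  qed
  moreover have "closing (\<lambda>x y. {p x, q x})"
    unfolding closing_def using pq S_Field by auto
  ultimately show ?thesis by blast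
qed

text \<open>Two distinct common cluster points would have neighbourhoods with disjoint closures, yet
  \<open>diagonal_in_closure\<close> puts a single diagonal value \<open>f d d\<close> into
  both.\<close>

lemma tail_limit_unique:
  assumes w: "\<And>m. m \<in> Field r \<Longrightarrow> w \<in> X closure_of (high m)"
    and w': "\<And>m. m \<in> Field r \<Longrightarrow> w' \<in> X closure_of (high m)"
  shows "w = w'"
proof (rule ccontr)
  assume "w \<noteq> w'"
  obtain c where c: "c \<in> Field r"
    using infinite_Field by (metis finite.emptyI ex_in_conv)
  then have ww: "w \<in> topspace X" "w' \<in> topspace X"
    using w[OF c] w'[OF c] closure_of_subset_topspace by (metis subsetD)+
  then obtain T T' where T: "openin X T" "openin X T'" "w \<in> T" "w' \<in> T'" "disjnt T T'"
    using Hausdorff \<open>w \<noteq> w'\<close> unfolding Hausdorff_space_def by blast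
  have *: "\<exists>V. openin X V \<and> v \<in> V \<and> X closure_of V \<subseteq> T" if v: "openin X T" "v \<in> T" for v T
  proof -
    have "neighbourhood_base_of (closedin X) X"
      using regular_space by (simp add: neighbourhood_base_of_closedin)
    then obtain V C where "openin X V" "closedin X C" "v \<in> V" "V \<subseteq> C" "C \<subseteq> T"
      using v unfolding neighbourhood_base_of by meson
    then show ?thesis
      using closure_of_minimal[of V C X] by blast
  qed
  obtain V V' where V: "openin X V" "w \<in> V" "X closure_of V \<subseteq> T"
    and V': "openin X V'" "w' \<in> V'" "X closure_of V' \<subseteq> T'"
    using *[OF T(1,3)] *[OF T(2,4)] by blast
  have "V \<inter> high m \<noteq> {}" if "m \<in> Field r" for m
    using w[OF that] V unfolding in_closure_of by blast
  then obtain B where B: "closing B"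
    "\<And>c d. d \<in> S \<Longrightarrow> c \<prec> d \<Longrightarrow> closed_under B d \<Longrightarrow> f d d \<in> X closure_of V"
    using diagonal_in_closure[of V] by blast
  have "V' \<inter> high m \<noteq> {}" if "m \<in> Field r" for m
    using w'[OF that] V' unfolding in_closure_of by blast
  then obtain B' where B': "closing B'"
    "\<And>c d. d \<in> S \<Longrightarrow> c \<prec> d \<Longrightarrow> closed_under B' d \<Longrightarrow> f d d \<in> X closure_of V'"
    using diagonal_in_closure[of V'] by blast
  obtain d where d: "d \<in> S" "c \<prec> d" "closed_under (\<lambda>x y. B x y \<union> B' x y) d"
    using stationary_closed[OF closing_Un[OF B(1) B'(1)] c] by blast
  have "f d d \<in> T \<inter> T'"
    using B(2)[OF d(1,2)] B'(2)[OF d(1,2)] d(3) V(3) V'(3) unfolding closed_under_Un by blast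
  then show False
    using T(5) by (auto simp: disjnt_iff)
qed

text \<open>By \<open>tail_limit_unique\<close> and injectivity along the row, at most one index
  \<open>y0\<close> gives a point in the closures of all tail squares. If it exists, it serves as
  the threshold.\<close>

lemma row_avoids_high:
  assumes a: "a \<in> S"
  shows "\<exists>k\<in>Field r. \<forall>y\<in>S. k \<prec> y \<longrightarrow> (\<exists>m\<in>Field r. f a y \<notin> X closure_of (high m))"
proof (cases "\<exists>y\<in>S. \<forall>m\<in>Field r. f a y \<in> X closure_of (high m)")
  case True
  then obtain y0 where y0: "y0 \<in> S" "\<And>m. m \<in> Field r \<Longrightarrow> f a y0 \<in> X closure_of (high m)"
    by blast
  have "\<exists>m\<in>Field r. f a y \<notin> X closure_of (high m)" if y: "y \<in> S" "y0 \<prec> y" for y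
  proof (rule ccontr)
    assume neg: "\<not> ?thesis"
    have "f a y = f a y0"
      by (rule tail_limit_unique) (use neg y0(2) in blast)+
    then have "y = y0"
      using f_inj_right[OF a y(1) y0(1)] by blast
    then show False
      using y(2) by simp
  qed
  then show ?thesis
    using y0(1) S_Field by blast
next
  case False
  have "a \<in> Field r"
    using a S_Field by blast
  then show ?thesis
    using False by blast
qed

end

section \<open>Graphs of fast growing functions\<close>

locale stationary_square_bounds = stationary_square r S X f
  for r :: "'k rel" and S :: "'k set" and X :: "'a topology" and f :: "'k \<Rightarrow> 'k \<Rightarrow> 'a" +
  fixes k0 :: "'k \<Rightarrow> 'k \<Rightarrow> 'k" and k1 :: "'k \<Rightarrow> 'k" and m :: "'k \<Rightarrow> 'k \<Rightarrow> 'k"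
    and B :: "'k \<Rightarrow> 'k \<Rightarrow> 'k set" and c0 :: 'k
  assumes k0: "\<And>a n y. a \<in> S \<Longrightarrow> n \<in> Field r \<Longrightarrow> y \<in> S \<Longrightarrow> k0 a n \<prec> y \<Longrightarrow> f a y \<notin> X closure_of (low n)"
    and m: "\<And>a y. a \<in> S \<Longrightarrow> y \<in> S \<Longrightarrow> k1 a \<prec> y \<Longrightarrow> f a y \<notin> X closure_of (high (m a y))"
    and B: "closing B"
    and B_k0: "\<And>a n. a \<in> S \<Longrightarrow> n \<in> Field r \<Longrightarrow> k0 a n \<in> B a n"
    and B_k1: "\<And>a y. a \<in> S \<Longrightarrow> k1 a \<in> B a y"
    and B_m: "\<And>a y. a \<in> S \<Longrightarrow> y \<in> S \<Longrightarrow> k1 a \<prec> y \<Longrightarrow> m a y \<in> B a y"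
    and c0: "c0 \<in> Field r"
begin

text \<open>The trace of a club on \<open>S\<close>. The bound \<open>c0\<close> makes continuity
  applicable at every member, and closure under \<open>B\<close> puts a member above the thresholds
  that \<open>B\<close> records for smaller arguments.\<close>

definition T :: "'k set"
  where "T = {d \<in> S. c0 \<prec> d \<and> closed_under B d}"

text \<open>Passing the thresholds takes \<open>f a (h a)\<close> out of the closures of
  \<open>low a\<close> and of some tail square, while \<open>h a \<in> B a a\<close> keeps
  \<open>h a\<close> below every later point of \<open>T\<close>.\<close>

definition good :: "('k \<Rightarrow> 'k) \<Rightarrow> bool"
  where "good h \<longleftrightarrow> (\<forall>a\<in>S. h a \<in> S \<and> a \<prec> h a \<and> k0 a a \<prec> h a \<and> k1 a \<prec> h a \<and> h a \<in> B a a)"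

lemma T_S: "a \<in> T \<Longrightarrow> a \<in> S" and T_c0: "a \<in> T \<Longrightarrow> c0 \<prec> a" and T_Field: "a \<in> T \<Longrightarrow> a \<in> Field r"
  using S_Field by (auto simp: T_def)

lemma T_closed: "a \<in> T \<Longrightarrow> x \<prec> a \<Longrightarrow> y \<prec> a \<Longrightarrow> b \<in> B x y \<Longrightarrow> b \<prec> a"
  unfolding T_def closed_under_def by blast

lemma goodD:
  assumes "good h" "a \<in> S"
  shows "h a \<in> S" "a \<prec> h a" "k0 a a \<prec> h a" "k1 a \<prec> h a" "h a \<in> B a a"
  using assms unfolding good_def by blast+

lemma good_T: "good h \<Longrightarrow> a \<in> S \<Longrightarrow> d \<in> T \<Longrightarrow> a \<prec> d \<Longrightarrow> h a \<prec> d"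
  using T_closed[of d a a "h a"] goodD(5) by blast

text \<open>A point of \<open>T\<close> above \<open>a\<close> and \<open>y\<close> is also above
  \<open>m a y\<close>, so the graph over \<open>A\<close> lies in the tail square that
  \<open>f a y\<close> avoids.\<close>

lemma f_notin_closure_high:
  assumes "a \<in> S" "y \<in> S" "k1 a \<prec> y"
    and A: "\<And>b. b \<in> A \<Longrightarrow> b \<in> T \<and> a \<prec> b \<and> y \<prec> b" and h: "good h"
  shows "f a y \<notin> X closure_of ((\<lambda>b. f b (h b)) ` A)"
proof -
  have "f b (h b) \<in> high (m a y)" if b: "b \<in> A" for b
  proof -
    have "m a y \<prec> b" "b \<in> S"
      using A[OF b] T_closed[OF _ _ _ B_m[OF assms(1-3)]] T_S by blast+
    moreover have "m a y \<prec> h b"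
      using \<open>m a y \<prec> b\<close> goodD(2)[OF h \<open>b \<in> S\<close>] lt_trans by blast
    ultimately show ?thesis
      using goodD(1)[OF h] unfolding high_def by blast
  qed
  then have "X closure_of ((\<lambda>b. f b (h b)) ` A) \<subseteq> X closure_of (high (m a y))"
    by (intro closure_of_mono) blast
  then show ?thesis
    using m[OF assms(1-3)] by blast
qed

text \<open>For \<open>b\<close> below \<open>n\<close> also \<open>h b\<close> is below
  \<open>n\<close>, so the graph over \<open>A\<close> lies in \<open>low n\<close>.\<close>

lemma f_notin_closure_low:
  assumes "a \<in> S" "n \<in> T" "y \<in> S" "k0 a n \<prec> y"
    and A: "\<And>b. b \<in> A \<Longrightarrow> b \<in> S \<and> b \<prec> n" and h: "good h"
  shows "f a y \<notin> X closure_of ((\<lambda>b. f b (h b)) ` A)"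
proof -
  have "f b (h b) \<in> low n" if b: "b \<in> A" for b
    using A[OF b] good_T[OF h _ assms(2)] goodD(1)[OF h] unfolding low_def by blast
  then have "X closure_of ((\<lambda>b. f b (h b)) ` A) \<subseteq> X closure_of (low n)"
    by (intro closure_of_mono) blast
  then show ?thesis
    using k0[OF assms(1) T_Field[OF assms(2)] assms(3,4)] by blast
qed

lemma f_notin_closure_single:
  assumes "z \<in> topspace X" "w \<noteq> z"
  shows "w \<notin> X closure_of {z}"
  using closedin_t1_singleton[OF t1 assms(1)] assms(2) by (simp add: closure_of_closedin)

text \<open>Split the graph of \<open>h'\<close> at \<open>a\<close>: its lower part lies in an
  initial square and its upper part in a tail square, whose closures miss \<open>f a (h a)\<close>
  by the growth of \<open>h\<close>. The single point over \<open>a\<close> is different because the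
  values of \<open>h\<close> and \<open>h'\<close> are.\<close>

lemma graph_separated:
  assumes h: "good h" and h': "good h'" and ne: "\<And>a. a \<in> S \<Longrightarrow> h a \<noteq> h' a" and a: "a \<in> T"
  shows "f a (h a) \<notin> X closure_of ((\<lambda>b. f b (h' b)) ` T)"
proof -
  have S: "a \<in> S" and hS: "h a \<in> S" "h' a \<in> S"
    using T_S[OF a] goodD(1) h h' by blast+
  let ?F = "\<lambda>A. (\<lambda>b. f b (h' b)) ` A"
  let ?L = "{b \<in> T. b \<prec> a}" and ?H = "{b \<in> T. a \<prec> b}"
  have "T = ?L \<union> {a} \<union> ?H"
    using a lt_total[of _ a] T_Field by blast
  then have T: "?F T = ?F ?L \<union> {f a (h' a)} \<union> ?F ?H"
    by auto
  have "f a (h a) \<notin> X closure_of (?F ?L)"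
    using goodD(3)[OF h S] S hS a h' T_S by (intro f_notin_closure_low[of a a]) auto
  moreover have "f a (h a) \<notin> X closure_of {f a (h' a)}"
    using f_inj_right[OF S hS] ne[OF S] f_topspace[OF S hS(2)] by (intro f_notin_closure_single) auto
  moreover have "f a (h a) \<notin> X closure_of (?F ?H)"
    using goodD(4)[OF h S] S hS h' good_T[OF h S] by (intro f_notin_closure_high) auto
  ultimately show ?thesis
    unfolding T closure_of_Un by simp
qed

lemma closure_graph:
  assumes h: "good h" and x: "x \<in> S" and d: "d \<in> T" "x \<prec> d" "c0 \<prec> x"
    and limit: "\<And>u. u \<prec> d \<Longrightarrow> \<exists>v\<in>T. u \<prec> v \<and> v \<prec> d"
    and mem: "f x d \<in> X closure_of ((\<lambda>b. f b (h b)) ` T)"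
  shows "f x d = f d (h d)"
proof (rule ccontr)
  assume ne: "f x d \<noteq> f d (h d)"
  have S: "d \<in> S" and hS: "h d \<in> S"
    using T_S[OF d(1)] goodD(1) h by blast+
  have "f x d \<noteq> f d d"
    using f_inj_left[OF x S S] d(2) by auto
  then obtain V W where VW: "openin X V" "openin X W" "f d d \<in> V" "f x d \<in> W" "disjnt V W"
    using Hausdorff f_topspace x S unfolding Hausdorff_space_def by metis
  obtain g g' where g: "g \<prec> d" "g' \<prec> d"
    "\<And>u v. u \<in> S \<Longrightarrow> v \<in> S \<Longrightarrow> g \<prec> u \<Longrightarrow> \<not> d \<prec> u \<Longrightarrow> g' \<prec> v \<Longrightarrow> \<not> d \<prec> v \<Longrightarrow> f u v \<in> V"
    using f_continuous[OF S S d(2) d(2) VW(1,3)] by blast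
  obtain u where u: "u \<prec> d" "\<not> u \<prec> g" "\<not> u \<prec> g'"
    using g(1,2) lt_total[of g g'] lt_Field[of g d] lt_Field[of g' d] lt_trans[of g g' g] lt_irrefl by blast
  \<comment> \<open>The cut between far below \<open>d\<close> and close to \<open>d\<close>. Since
    \<open>k0 x n\<close> is below \<open>d\<close>, the closure of \<open>low n\<close> misses
    \<open>f x d\<close>; for \<open>b\<close> from \<open>n\<close> up to but excluding
    \<open>d\<close>, both \<open>b\<close> and \<open>h b\<close> are so close to \<open>d\<close>
    that the graph point lies in \<open>V\<close>.\<close>
  obtain n where n: "n \<in> T" "u \<prec> n" "n \<prec> d"
    using limit[OF u(1)] by blast
  have gn: "g \<prec> n" "g' \<prec> n"
    using not_lt_lt_trans[OF u(2) n(2)] not_lt_lt_trans[OF u(3) n(2)] g lt_Field by blast+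
  let ?F = "\<lambda>A. (\<lambda>b. f b (h b)) ` A"
  let ?L = "{b \<in> T. b \<prec> n}" and ?M = "{b \<in> T. b \<prec> d \<and> \<not> b \<prec> n}" and ?H = "{b \<in> T. d \<prec> b}"
  have "T = ?L \<union> ?M \<union> {d} \<union> ?H"
    using d(1) lt_total[of _ d] T_Field lt_trans[of _ n d] n(3) by blast
  then have T: "?F T = ?F ?L \<union> ?F ?M \<union> {f d (h d)} \<union> ?F ?H"
    by auto
  have "f x d \<notin> X closure_of (?F ?L)"
    using T_closed[OF d(1,2) n(3) B_k0[OF x T_Field[OF n(1)]]] x S n(1) h T_S
    by (intro f_notin_closure_low[of x n]) auto
  moreover have "f x d \<notin> X closure_of {f d (h d)}"
    using ne f_topspace[OF S hS] by (intro f_notin_closure_single) auto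
  moreover have "f x d \<notin> X closure_of (?F ?H)"
    using T_closed[OF d(1,2,2) B_k1[OF x]] x S h lt_trans[OF d(2)]
    by (intro f_notin_closure_high) auto
  moreover have "f x d \<notin> X closure_of (?F ?M)"
  proof -
    have "f b (h b) \<in> V" if b: "b \<in> T" "b \<prec> d" "\<not> b \<prec> n" for b
    proof -
      have bS: "b \<in> S" "b \<in> Field r"
        using T_S T_Field b(1) by blast+
      have hb: "h b \<prec> d" "b \<prec> h b" "h b \<in> S"
        using good_T[OF h bS(1) d(1) b(2)] goodD(1,2)[OF h bS(1)] by blast+
      have gb: "g \<prec> b" "g' \<prec> b"
        using lt_not_lt_trans[OF gn(1) b(3) bS(2)] lt_not_lt_trans[OF gn(2) b(3) bS(2)] by blast+
      show ?thesis
        using lt_trans[of d b d] lt_trans[of d "h b" d] lt_trans[OF gb(2) hb(2)] hb b(2) gb bS(1)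
        by (intro g(3)) auto
    qed
    then have "?F ?M \<subseteq> V"
      by blast
    then show ?thesis
      using VW by (auto simp: in_closure_of disjnt_iff)
  qed
  ultimately show False
    using mem unfolding T closure_of_Un by simp
qed

text \<open>
  An unbounded fibre of the regressive function suffices here, and that only takes one \<open>d\<close>
  closed under bounds of the fibres.
\<close>

lemma press_down:
  assumes h: "good h" and U: "openin X U" "(\<lambda>b. f b (h b)) ` T \<subseteq> U"
  shows "\<exists>g\<in>Field r. \<forall>c\<in>Field r. \<exists>a\<in>T. c \<prec> a \<and> (\<forall>x\<in>S. g \<prec> x \<longrightarrow> \<not> a \<prec> x \<longrightarrow> f x (h a) \<in> U)"
proof -
  have "\<exists>g. g \<prec> a \<and> (\<forall>x\<in>S. g \<prec> x \<longrightarrow> \<not> a \<prec> x \<longrightarrow> f x (h a) \<in> U)" if a: "a \<in> T" for a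
  proof -
    note S = T_S[OF a]
    have "f a (h a) \<in> U"
      using U(2) a by blast
    then obtain g g' where "g \<prec> a" "g' \<prec> h a"
      "\<forall>x\<in>S. \<forall>y\<in>S. g \<prec> x \<longrightarrow> \<not> a \<prec> x \<longrightarrow> g' \<prec> y \<longrightarrow> \<not> h a \<prec> y \<longrightarrow> f x y \<in> U"
      using f_continuous[OF S goodD(1)[OF h S] T_c0[OF a] lt_trans[OF T_c0[OF a] goodD(2)[OF h S]] U(1)]
      by blast
    \<comment> \<open>Only the first coordinate is moved; the second stays at
      \<open>h a\<close>.\<close>
    then show ?thesis
      using goodD(1)[OF h S] lt_irrefl[of "h a"] by blast
  qed
  then obtain g where g: "\<And>a. a \<in> T \<Longrightarrow> g a \<prec> a"
    "\<And>a x. a \<in> T \<Longrightarrow> x \<in> S \<Longrightarrow> g a \<prec> x \<Longrightarrow> \<not> a \<prec> x \<Longrightarrow> f x (h a) \<in> U"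
    by metis
  have "\<exists>e\<in>Field r. \<forall>c\<in>Field r. \<exists>a\<in>T. c \<prec> a \<and> g a = e"
  proof (rule ccontr)
    assume "\<not> ?thesis"
    then obtain b where b: "\<And>e. e \<in> Field r \<Longrightarrow> b e \<in> Field r"
      "\<And>e a. e \<in> Field r \<Longrightarrow> a \<in> T \<Longrightarrow> b e \<prec> a \<Longrightarrow> g a \<noteq> e"
      by metis
    have "closing (\<lambda>x y. {b x})"
      using b(1) by (simp add: closing_def)
    then obtain d where d: "d \<in> S" "c0 \<prec> d" "closed_under (\<lambda>x y. B x y \<union> {b x}) d"
      using stationary_closed[OF closing_Un[OF B] c0] by blast
    then have "d \<in> T"
      unfolding T_def closed_under_Un by simp
    \<comment> \<open>Since \<open>g d\<close> is below \<open>d\<close>, so is the bound of its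
      fibre, although \<open>d\<close> itself belongs to that fibre.\<close>
    moreover have "b (g d) \<prec> d"
      using d(3) g(1)[OF \<open>d \<in> T\<close>] unfolding closed_under_def by blast
    ultimately show False
      using b(2)[of "g d" d] g(1) lt_Field by blast
  qed
  then obtain e where e: "e \<in> Field r" "\<And>c. c \<in> Field r \<Longrightarrow> \<exists>a\<in>T. c \<prec> a \<and> g a = e"
    by blast
  have "\<exists>a\<in>T. c \<prec> a \<and> (\<forall>x\<in>S. e \<prec> x \<longrightarrow> \<not> a \<prec> x \<longrightarrow> f x (h a) \<in> U)" if "c \<in> Field r" for c
    using e(2)[OF that] g(2) by blast
  then show ?thesis
    using e(1) by blast
qed

text \<open>As \<open>a\<close> approaches \<open>d\<close>, the value \<open>h a\<close> is
  squeezed between \<open>a\<close> and \<open>d\<close>, so the points \<open>f x (h a)\<close> of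
  \<open>U\<close> converge to \<open>f x d\<close>.\<close>

lemma closure_point:
  assumes h: "good h"
    and x: "x \<in> S" "g \<prec> x" and d: "d \<in> T" "x \<prec> d"
    and step: "\<And>c. c \<prec> d \<Longrightarrow> \<exists>a\<in>T. c \<prec> a \<and> a \<prec> d \<and> (\<forall>x\<in>S. g \<prec> x \<longrightarrow> \<not> a \<prec> x \<longrightarrow> f x (h a) \<in> U)"
  shows "f x d \<in> X closure_of U"
  unfolding in_closure_of
proof (intro conjI allI impI)
  note S = T_S[OF d(1)]
  show "f x d \<in> topspace X"
    using f_topspace[OF x(1) S] .
  fix W assume W: "f x d \<in> W \<and> openin X W"
  obtain e e' where e: "e \<prec> x" "e' \<prec> d"
    "\<And>u v. u \<in> S \<Longrightarrow> v \<in> S \<Longrightarrow> e \<prec> u \<Longrightarrow> \<not> x \<prec> u \<Longrightarrow> e' \<prec> v \<Longrightarrow> \<not> d \<prec> v \<Longrightarrow> f u v \<in> W"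
    using f_continuous[OF x(1) S x(2) lt_trans[OF x(2) d(2)], of W] W by blast
  obtain c where c: "c \<prec> d" "\<not> c \<prec> e'" "\<not> c \<prec> x"
    using e(2) d(2) lt_total[of e' x] lt_Field[of e' d] lt_Field[of x d] lt_trans[of e' x e'] lt_irrefl by blast
  obtain a where a: "a \<in> T" "c \<prec> a" "a \<prec> d"
    "\<And>x. x \<in> S \<Longrightarrow> g \<prec> x \<Longrightarrow> \<not> a \<prec> x \<Longrightarrow> f x (h a) \<in> U"
    using step[OF c(1)] by blast
  note aS = T_S[OF a(1)]
  have xa: "x \<prec> a" "e' \<prec> a"
    using not_lt_lt_trans[OF c(3) a(2)] not_lt_lt_trans[OF c(2) a(2)] lt_Field x d e by blast+
  have ha: "h a \<in> S" "a \<prec> h a" "h a \<prec> d"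
    using goodD(1,2)[OF h aS] good_T[OF h aS d(1) a(3)] by blast+
  have "f x (h a) \<in> W"
    using lt_trans[OF xa(2) ha(2)] lt_trans[of d "h a" d] ha x(1) e(1) by (intro e(3)) auto
  moreover have "f x (h a) \<in> U"
    using a(4)[OF x] xa(1) lt_trans[of x a x] by auto
  ultimately show "\<exists>y. y \<in> U \<and> y \<in> W"
    by blast
qed

lemma good_contradiction:
  assumes h: "good h" and h': "good h'" and ne: "\<And>a. a \<in> S \<Longrightarrow> h a \<noteq> h' a"
  shows False
proof -
  let ?F = "\<lambda>h. (\<lambda>b. f b (h b)) ` T"
  have sub: "?F h \<subseteq> topspace X" if "good h" for h
    using f_topspace T_S goodD(1)[OF that] by blast
  have "separatedin X (?F h) (?F h')"
    unfolding separatedin_def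
    using graph_separated[OF h h' ne] graph_separated[OF h' h ne[symmetric]] sub h h' by auto
  then obtain U U' where U: "openin X U" "openin X U'" "?F h \<subseteq> U" "?F h' \<subseteq> U'"
    "X closure_of U \<inter> X closure_of U' \<subseteq> X closure_of ?F h \<inter> X closure_of ?F h'"
    using hereditarily_normal_separation_closures[OF normal] by blast
  obtain g p where g: "g \<in> Field r" and p: "\<And>c. c \<in> Field r \<Longrightarrow> p c \<in> T \<and> c \<prec> p c \<and>
      (\<forall>x\<in>S. g \<prec> x \<longrightarrow> \<not> p c \<prec> x \<longrightarrow> f x (h (p c)) \<in> U)"
    using press_down[OF h U(1,3)] by metis
  obtain g' p' where g': "g' \<in> Field r" and p': "\<And>c. c \<in> Field r \<Longrightarrow> p' c \<in> T \<and> c \<prec> p' c \<and>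
      (\<forall>x\<in>S. g' \<prec> x \<longrightarrow> \<not> p' c \<prec> x \<longrightarrow> f x (h' (p' c)) \<in> U')"
    using press_down[OF h' U(2,4)] by metis
  \<comment> \<open>A single row beyond both pressed-down bounds serves both graphs.\<close>
  obtain x where x: "x \<in> S" "g \<prec> x" "g' \<prec> x" "c0 \<prec> x"
    using exists_S_greater[of "{g, g', c0}"] g g' c0 by auto
  \<comment> \<open>Closure under the selectors \<open>p\<close> and \<open>p'\<close> makes the
    selected indices cofinal in \<open>d\<close>; in particular \<open>d\<close> is a limit of
    points of \<open>T\<close>.\<close>
  have "closing (\<lambda>x y. {p x, p' x})"
    unfolding closing_def using p p' T_Field by auto
  then obtain d where d: "d \<in> S" "x \<prec> d" "closed_under (\<lambda>x y. B x y \<union> {p x, p' x}) d"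
    using stationary_closed[OF closing_Un[OF B], of _ x] x(1) S_Field by blast
  have dT: "d \<in> T"
    using d lt_trans[OF x(4) d(2)] unfolding T_def closed_under_Un by simp
  have pd: "p c \<prec> d" "p' c \<prec> d" if "c \<prec> d" for c
    using d(3) that unfolding closed_under_def by blast+
  have "f x d \<in> X closure_of U"
    using p pd lt_Field by (intro closure_point[OF h x(1,2) dT d(2)]) blast
  moreover have "f x d \<in> X closure_of U'"
    using p' pd lt_Field by (intro closure_point[OF h' x(1,3) dT d(2)]) blast
  ultimately have *: "f x d \<in> X closure_of ?F h" "f x d \<in> X closure_of ?F h'"
    using U(5) by blast+
  have limit: "\<exists>v\<in>T. u \<prec> v \<and> v \<prec> d" if "u \<prec> d" for u
    using p pd[OF that] lt_Field[OF that] by blast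
  have "f d (h d) = f d (h' d)"
    using closure_graph[OF h x(1) dT d(2) x(4) limit *(1)] closure_graph[OF h' x(1) dT d(2) x(4) limit *(2)]
    by simp
  then have "h d = h' d"
    using f_inj_right[OF d(1)] goodD(1)[OF h d(1)] goodD(1)[OF h' d(1)] by blast
  then show False
    using ne d(1) by blast
qed

end

section \<open>Choice of the thresholds and of two functions\<close>

context stationary_square
begin

lemma stationary_square_False: False
proof -
  obtain c0 where c0: "c0 \<in> Field r"
    using infinite_Field by (metis finite.emptyI ex_in_conv)
  have "\<exists>k\<in>Field r. \<forall>y\<in>S. k \<prec> y \<longrightarrow> f a y \<notin> X closure_of (low n)" if "a \<in> S" "n \<in> Field r" for a n
    using row_avoids_low that by blast
  then obtain k0 where k0: "\<And>a n. a \<in> S \<Longrightarrow> n \<in> Field r \<Longrightarrow> k0 a n \<in> Field r"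
    "\<And>a n y. a \<in> S \<Longrightarrow> n \<in> Field r \<Longrightarrow> y \<in> S \<Longrightarrow> k0 a n \<prec> y \<Longrightarrow> f a y \<notin> X closure_of (low n)"
    by metis
  obtain k1 where k1: "\<And>a. a \<in> S \<Longrightarrow> k1 a \<in> Field r"
    "\<And>a y. a \<in> S \<Longrightarrow> y \<in> S \<Longrightarrow> k1 a \<prec> y \<Longrightarrow> \<exists>m\<in>Field r. f a y \<notin> X closure_of (high m)"
    using row_avoids_high by metis
  then obtain m where m: "\<And>a y. a \<in> S \<Longrightarrow> y \<in> S \<Longrightarrow> k1 a \<prec> y \<Longrightarrow> m a y \<in> Field r"
    "\<And>a y. a \<in> S \<Longrightarrow> y \<in> S \<Longrightarrow> k1 a \<prec> y \<Longrightarrow> f a y \<notin> X closure_of (high (m a y))"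
    by metis
  have SF: "a \<in> S \<Longrightarrow> a \<in> Field r" for a
    using S_Field by blast
  have "\<exists>b\<in>S. a \<prec> b \<and> k0 a a \<prec> b \<and> k1 a \<prec> b" if a: "a \<in> S" for a
    using exists_S_greater[of "{a, k0 a a, k1 a}"] SF[OF a] k0(1)[OF a SF[OF a]] k1(1)[OF a] by simp
  then obtain h where h: "\<And>a. a \<in> S \<Longrightarrow> h a \<in> S \<and> a \<prec> h a \<and> k0 a a \<prec> h a \<and> k1 a \<prec> h a"
    by metis
  \<comment> \<open>The second function is chosen above the first, so that the two differ everywhere
    on \<open>S\<close>.\<close>
  have "\<exists>b\<in>S. a \<prec> b \<and> k0 a a \<prec> b \<and> k1 a \<prec> b \<and> h a \<prec> b" if a: "a \<in> S" for a
    using exists_S_greater[of "{a, k0 a a, k1 a, h a}"] SF[OF a] k0(1)[OF a SF[OF a]] k1(1)[OF a] h[OF a] SF[of "h a"]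
    by simp
  then obtain h' where h': "\<And>a. a \<in> S \<Longrightarrow> h' a \<in> S \<and> a \<prec> h' a \<and> k0 a a \<prec> h' a \<and> k1 a \<prec> h' a \<and> h a \<prec> h' a"
    by metis
  \<comment> \<open>One operation records all choices; its second argument acts as \<open>n\<close>
    for \<open>k0\<close> and as \<open>y\<close> for \<open>m\<close>. The intersection discards
    choice values left unspecified, which could fall outside \<open>Field r\<close>.\<close>
  define B where "B a y = {k0 a y, k1 a, h a, h' a, m a y} \<inter> Field r" for a y
  have B: "closing B"
    unfolding closing_def B_def by (auto intro: countable_finite)
  interpret stationary_square_bounds r S X f k0 k1 m B c0
    by unfold_locales (use k0 k1(1) m B c0 in \<open>simp_all add: B_def\<close>)
  have "good h" "good h'"
    using h h' SF by (simp_all add: good_def B_def)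
  moreover have "h a \<noteq> h' a" if "a \<in> S" for a
    using h'[OF that] by auto
  ultimately show False
    using good_contradiction by blast
qed

end

section \<open>Paratopological groups\<close>

lemma collectionwise_normal_imp_normal:
  assumes "collectionwise_normal X"
  shows "normal_space X"
  unfolding normal_space_def
proof (intro allI impI, elim conjE)
  fix S T assume S: "closedin X S" and T: "closedin X T" and ST: "disjnt S T"
  show "\<exists>U V. openin X U \<and> openin X V \<and> S \<subseteq> U \<and> T \<subseteq> V \<and> disjnt U V"
  proof (cases "S = T")
    \<comment> \<open>Then both sets are empty, and \<open>{S, T}\<close> collapses to one member,
      so this case is separate.\<close>
    case True
    then show ?thesis
      using ST by (intro exI[of _ "{}"]) auto
  next
    case False
    have "discrete_family X {S, T}"
      unfolding discrete_family_def
    proof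
      fix x assume x: "x \<in> topspace X"
      have "\<exists>V. openin X V \<and> x \<in> V \<and> (V \<inter> S = {} \<or> V \<inter> T = {})"
      proof (cases "x \<in> S")
        case True
        then show ?thesis
          using x T ST by (intro exI[of _ "topspace X - T"]) (auto simp: disjnt_iff)
      next
        case False
        then show ?thesis
          using x S by (intro exI[of _ "topspace X - S"]) auto
      qed
      then show "\<exists>V. openin X V \<and> x \<in> V \<and>
          (\<forall>F\<in>{S, T}. \<forall>F'\<in>{S, T}. F \<inter> V \<noteq> {} \<and> F' \<inter> V \<noteq> {} \<longrightarrow> F = F')"
        by (auto simp: Int_commute)
    qed
    then obtain U where "\<forall>F\<in>{S, T}. openin X (U F) \<and> F \<subseteq> U F"
      "\<forall>F\<in>{S, T}. \<forall>F'\<in>{S, T}. F \<noteq> F' \<longrightarrow> disjnt (U F) (U F')"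
      using assms S T unfolding collectionwise_normal_def by (metis insert_iff singletonD)
    then show ?thesis
      using False by (intro exI[of _ "U S"] exI[of _ "U T"]) auto
  qed
qed

text \<open>The singletons of a closed discrete set form a discrete family of closed sets.\<close>

lemma collectionwise_normal_imp_collectionwise_Hausdorff:
  assumes "collectionwise_normal X"
  shows "collectionwise_Hausdorff X"
  unfolding collectionwise_Hausdorff_def
proof (intro allI impI, elim conjE)
  fix D assume D: "closedin X D" "subtopology X D = discrete_topology D"
  let ?F = "(\<lambda>d. {d}) ` D"
  have "closedin X F" if "F \<in> ?F" for F
  proof -
    have "closedin (subtopology X D) F"
      using that D(2) by auto
    then show ?thesis
      using D(1) closedin_trans_full by blast
  qed
  moreover have "discrete_family X ?F"
    unfolding discrete_family_def
  proof
    fix x assume x: "x \<in> topspace X"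
    show "\<exists>V. openin X V \<and> x \<in> V \<and>
        (\<forall>F\<in>?F. \<forall>F'\<in>?F. F \<inter> V \<noteq> {} \<and> F' \<inter> V \<noteq> {} \<longrightarrow> F = F')"
    proof (cases "x \<in> D")
      case True
      then have "openin (subtopology X D) {x}"
        using D(2) by simp
      then obtain V where V: "openin X V" "{x} = V \<inter> D"
        unfolding openin_subtopology by blast
      then have "d = x" if "d \<in> D" "d \<in> V" for d
        using that by auto
      then show ?thesis
        using V by (intro exI[of _ V]) fastforce
    next
      case False
      then show ?thesis
        using x D(1) by (intro exI[of _ "topspace X - D"]) auto
    qed
  qed
  ultimately have "\<exists>U. (\<forall>F\<in>?F. openin X (U F) \<and> F \<subseteq> U F) \<and>
      (\<forall>F\<in>?F. \<forall>F'\<in>?F. F \<noteq> F' \<longrightarrow> disjnt (U F) (U F'))"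
    using assms unfolding collectionwise_normal_def by blast
  then obtain U where "(\<forall>F\<in>?F. openin X (U F) \<and> F \<subseteq> U F) \<and>
      (\<forall>F\<in>?F. \<forall>F'\<in>?F. F \<noteq> F' \<longrightarrow> disjnt (U F) (U F'))"
    by (rule exE)
  then show "\<exists>U. (\<forall>d\<in>D. openin X (U d) \<and> d \<in> U d) \<and>
      (\<forall>d\<in>D. \<forall>e\<in>D. d \<noteq> e \<longrightarrow> disjnt (U d) (U e))"
    by (intro exI[of _ "\<lambda>d. U {d}"]) auto
qed

section \<open>Multiplication and translations in a paratopological group\<close>

lemma paratopological_group_mult_nbhd:
  assumes "paratopological_group G X" "openin X U" "a \<in> carrier G" "b \<in> carrier G" "a \<otimes>\<^bsub>G\<^esub> b \<in> U"
  obtains V W where "openin X V" "openin X W" "a \<in> V" "b \<in> W"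
    "\<And>x y. x \<in> V \<Longrightarrow> y \<in> W \<Longrightarrow> x \<otimes>\<^bsub>G\<^esub> y \<in> U"
proof -
  let ?P = "{p \<in> topspace (prod_topology X X). fst p \<otimes>\<^bsub>G\<^esub> snd p \<in> U}"
  have top: "topspace X = carrier G"
    and "continuous_map (prod_topology X X) X (\<lambda>p. fst p \<otimes>\<^bsub>G\<^esub> snd p)"
    using assms(1) by (simp_all add: paratopological_group_def)
  then have "openin (prod_topology X X) ?P"
    using assms(2) by (intro openin_continuous_map_preimage)
  moreover have "(a, b) \<in> ?P"
    using assms top by simp
  ultimately obtain V W where "openin X V" "openin X W" "a \<in> V" "b \<in> W" "V \<times> W \<subseteq> ?P"
    unfolding openin_prod_topology_alt by meson
  then show thesis
    by (intro that[of V W]) auto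
qed

lemma paratopological_group_continuous_left_mult:
  assumes "paratopological_group G X" "g \<in> carrier G"
  shows "continuous_map X X (\<lambda>z. g \<otimes>\<^bsub>G\<^esub> z)"
proof -
  have "topspace X = carrier G"
    and c: "continuous_map (prod_topology X X) X (\<lambda>p. fst p \<otimes>\<^bsub>G\<^esub> snd p)"
    using assms(1) by (simp_all add: paratopological_group_def)
  then have "continuous_map X (prod_topology X X) (\<lambda>z. (g, z))"
    using assms(2) by (simp add: continuous_map_pairedI)
  from continuous_map_compose[OF this c] show ?thesis
    by (simp add: comp_def)
qed

text \<open>The products of \<open>e a\<close> and \<open>e b\<close> form a stationary square:
  joint continuity gives \<open>f_continuous\<close>, right cancellation gives
  \<open>f_inj_left\<close>, and left translations give \<open>f_embedding_right\<close>.\<close>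

lemma not_hereditarily_normal_and_collectionwise_Hausdorff:
  fixes G :: "('g, 'b) monoid_scheme" and X :: "'g topology" and r :: "'k rel"
  assumes G: "paratopological_group G X" and X: "Tychonoff_space X"
    and r: "uncountable_regular_cardinal r" and S: "stationary r S" and A: "A \<subseteq> topspace X"
    and hom: "subtopology X A homeomorphic_space subtopology (ord_topology r) S"
    and n: "hereditarily normal_space X" and c: "hereditarily collectionwise_Hausdorff X"
  shows False
proof -
  interpret r: regular_cardinal r
    by unfold_locales (rule r)
  interpret G: group G
    using G by (simp add: paratopological_group_def)
  have top: "topspace X = carrier G"
    using G by (simp add: paratopological_group_def)
  have SF: "S \<subseteq> Field r"
    using S by (simp add: stationary_def)
  have topS: "topspace (subtopology (ord_topology r) S) = S"
    using SF by (simp add: r.topspace_ord_topology Int_absorb1)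
  obtain e where e: "homeomorphic_map (subtopology (ord_topology r) S) (subtopology X A) e"
    using hom homeomorphic_space homeomorphic_space_sym by metis
  have inj: "inj_on e S"
    using homeomorphic_imp_injective_map[OF e] topS by simp
  have im: "e ` S = A"
    using homeomorphic_imp_surjective_map[OF e] topS A by (simp add: Int_absorb1)
  then have carrier: "e a \<in> carrier G" if "a \<in> S" for a
    using A top that by blast
  have cont: "\<exists>g. r.lt g a \<and> (\<forall>x\<in>S. r.lt g x \<longrightarrow> \<not> r.lt a x \<longrightarrow> e x \<in> U)"
    if a: "a \<in> S" "r.lt c a" and U: "openin X U" "e a \<in> U" for a c U
  proof -
    have "continuous_map (subtopology (ord_topology r) S) X e"
      using homeomorphic_imp_continuous_map[OF e] continuous_map_into_fulltopology by blast
    then have "openin (subtopology (ord_topology r) S) {x \<in> S. e x \<in> U}"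
      using openin_continuous_map_preimage[OF _ U(1)] topS by metis
    then obtain W where W: "openin (ord_topology r) W" "{x \<in> S. e x \<in> U} = W \<inter> S"
      unfolding openin_subtopology by blast
    then have "a \<in> W"
      using a U by blast
    then obtain g where "r.lt g a" "\<And>x. r.lt g x \<Longrightarrow> \<not> r.lt a x \<Longrightarrow> x \<in> W"
      using r.ord_topology_nbhd[OF W(1) _ a(2)] by blast
    then show ?thesis
      using W(2) by blast
  qed
  interpret stationary_square r S X "\<lambda>a b. e a \<otimes>\<^bsub>G\<^esub> e b"
  proof
    show "regular_space X" "Hausdorff_space X"
      using X by (simp_all add: Tychonoff_space_def completely_regular_imp_regular_space)
    show "e a \<otimes>\<^bsub>G\<^esub> e b \<in> topspace X" if "a \<in> S" "b \<in> S" for a b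
      using that carrier top by simp
    show "\<exists>g h. r.lt g a \<and> r.lt h b \<and> (\<forall>x\<in>S. \<forall>y\<in>S. r.lt g x \<longrightarrow> \<not> r.lt a x \<longrightarrow>
        r.lt h y \<longrightarrow> \<not> r.lt b y \<longrightarrow> e x \<otimes>\<^bsub>G\<^esub> e y \<in> U)"
      if *: "a \<in> S" "b \<in> S" "r.lt c a" "r.lt c b" "openin X U" "e a \<otimes>\<^bsub>G\<^esub> e b \<in> U" for a b c U
    proof -
      obtain V W where VW: "openin X V" "openin X W" "e a \<in> V" "e b \<in> W"
        "\<And>x y. x \<in> V \<Longrightarrow> y \<in> W \<Longrightarrow> x \<otimes>\<^bsub>G\<^esub> y \<in> U"
        using paratopological_group_mult_nbhd[OF G *(5) carrier[OF *(1)] carrier[OF *(2)] *(6)] by blast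
      show ?thesis
        using cont[OF *(1,3) VW(1,3)] cont[OF *(2,4) VW(2,4)] VW(5) by meson
    qed
    show "a = a'" if "a \<in> S" "a' \<in> S" "b \<in> S" "e a \<otimes>\<^bsub>G\<^esub> e b = e a' \<otimes>\<^bsub>G\<^esub> e b" for a a' b
      using that G.right_cancel carrier inj by (metis inj_onD)
    show "\<exists>V. openin X V \<and> e a \<otimes>\<^bsub>G\<^esub> e b \<in> V \<and>
        (\<forall>y\<in>S. e a \<otimes>\<^bsub>G\<^esub> e y \<in> V \<longrightarrow> r.lt c y \<and> \<not> r.lt b y)"
      if *: "a \<in> S" "b \<in> S" "r.lt c b" for a b c
    proof -
      let ?I = "{x. r.lt c x} \<inter> {x \<in> Field r. \<not> r.lt b x}"
      have "openin (ord_topology r) ?I"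
        using r.lt_Field[OF *(3)] by (intro openin_Int r.openin_gt r.openin_not_gt) auto
      then have "openin (subtopology (ord_topology r) S) (S \<inter> ?I)"
        by (simp add: openin_subtopology_Int2)
      then have "openin (subtopology X A) (e ` (S \<inter> ?I))"
        using homeomorphic_imp_open_map[OF e] by (auto simp: open_map_def)
      then obtain W where W: "openin X W" "e ` (S \<inter> ?I) = W \<inter> A"
        unfolding openin_subtopology by blast
      \<comment> \<open>The set \<open>W\<close> cuts out the interval \<open>?I\<close> on the
        embedded copy of \<open>S\<close>. Its preimage under left translation by the inverse of
        \<open>e a\<close> carries it to row \<open>a\<close>, and this is open since translation by
        a fixed element is continuous.\<close>
      let ?V = "{z \<in> topspace X. inv\<^bsub>G\<^esub> e a \<otimes>\<^bsub>G\<^esub> z \<in> W}"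
      have "openin X ?V"
        using paratopological_group_continuous_left_mult[OF G G.inv_closed[OF carrier[OF *(1)]]] W(1)
        by (rule openin_continuous_map_preimage)
      moreover have V: "e a \<otimes>\<^bsub>G\<^esub> e y \<in> ?V \<longleftrightarrow> e y \<in> W" if "y \<in> S" for y
        using carrier[OF *(1)] carrier[OF that] top by (simp add: G.m_assoc[symmetric])
      moreover have "e b \<in> W"
      proof -
        have "e b \<in> e ` (S \<inter> ?I)"
          using * SF by (intro imageI) auto
        then show ?thesis
          using W(2) by blast
      qed
      moreover have "r.lt c y \<and> \<not> r.lt b y" if "y \<in> S" "e y \<in> W" for y
      proof -
        have "e y \<in> e ` (S \<inter> ?I)"
          using W(2) that im by blast
        then show ?thesis
          using inj_on_image_mem_iff[OF inj that(1)] by blast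
      qed
      ultimately show ?thesis
        using *(2) by blast
    qed
  qed (use S n c in auto)
  show False
    by (rule stationary_square_False)
qed

theorem theorem2p4:
  fixes G :: "('g, 'b) monoid_scheme" and X :: "'g topology"
    and r :: "'k rel" and S :: "'k set" and A :: "'g set"
  assumes "paratopological_group G X"
    and "Tychonoff_space X"
    and "uncountable_regular_cardinal r"
    and "stationary r S"
    and "A \<subseteq> topspace X"
    and "subtopology X A homeomorphic_space subtopology (ord_topology r) S"
  shows "(\<not> hereditarily normal_space X \<or> \<not> hereditarily collectionwise_Hausdorff X)
         \<and> \<not> hereditarily collectionwise_normal X"
proof -
  have "\<not> (hereditarily normal_space X \<and> hereditarily collectionwise_Hausdorff X)"
    using not_hereditarily_normal_and_collectionwise_Hausdorff[OF assms] by blast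
  \<comment> \<open>Applied to each subspace, the two implications for collectionwise normality
    reduce the second claim to the first.\<close>
  moreover have "hereditarily normal_space X \<and> hereditarily collectionwise_Hausdorff X"
    if "hereditarily collectionwise_normal X"
    using hereditarily_mono[OF that] collectionwise_normal_imp_normal
      collectionwise_normal_imp_collectionwise_Hausdorff by blast
  ultimately show ?thesis
    by blast
qed

end
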